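(* For a commutative ring $R$ with $1\neq0$, the following are equivalent. (1) $R$ is strongly zero-dimensional. (2) For every prime ideal $P$ of $R$, the complement $R\setminus P$ is strongly multiplicative. (3) For every prime ideal $P$ of $R$, localization at $P$ commutes with arbitrary intersections of ideals; that is, $\bigl(\bigcap_{\lambda\in\Lambda}I_\lambda\bigr)_P=\bigcap_{\lambda\in\Lambda}(I_\lambda)_P$ inside $R_P$ for every family $(I_\lambda)_{\lambda\in\Lambda}$ of ideals of $R$. (4) $R$ is zero-dimensional and quasi-semilocal.
   Context: A prime ideal $P$ is strongly prime if for every family of ideals $(I_\lambda)_{\lambda\in\Lambda}$ with $\bigcap_{\lambda\in\Lambda}I_\lambda\subseteq P$ one has $I_\mu\subseteq P$ for some $\mu$. $R$ is strongly zero-dimensional if every prime ideal of $R$ is strongly prime. $R$ is quasi-semilocal if it has only finitely many maximal ideals; zero-dimensional means Krull dimension $0$. A multiplicative set $S$ of $R$ is a subset with $0\notin S$, $1\in S$, closed under products; it is strongly multiplicative if $\bigl(\bigcap_{i\in\Delta}s_iR\bigr)\cap S\neq\varnothing$ for every family $(s_i)_{i\in\Delta}$ of elements of $S$. *)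

theory Defs
  imports "HOL-Algebra.Algebra" "HOL-Library.Extended_Nat"
begin

(*
  Families (I_l) of ideals, and families (s_i) of ring elements, enter the definitions below only
  through the set of their members, so they are represented by sets.  The intersection of the
  empty family is the whole ring, hence the explicit "carrier R \<inter> ..." in front of \<Inter>; for a
  nonempty family of ideals this is just the intersection.
*)

definition strongly_prime :: "('a, 'b) ring_scheme \<Rightarrow> 'a set \<Rightarrow> bool" where
  "strongly_prime R P \<longleftrightarrow>
     primeideal P R \<and>
     (\<forall>F. (\<forall>I\<in>F. ideal I R) \<longrightarrow> carrier R \<inter> \<Inter>F \<subseteq> P \<longrightarrow> (\<exists>I\<in>F. I \<subseteq> P))"

definition strongly_zero_dimensional :: "('a, 'b) ring_scheme \<Rightarrow> bool" where
  "strongly_zero_dimensional R \<longleftrightarrow> (\<forall>P. primeideal P R \<longrightarrow> strongly_prime R P)"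

definition quasi_semilocal :: "('a, 'b) ring_scheme \<Rightarrow> bool" where
  "quasi_semilocal R \<longleftrightarrow> finite {M. maximalideal M R}"

definition prime_chain :: "('a, 'b) ring_scheme \<Rightarrow> nat \<Rightarrow> (nat \<Rightarrow> 'a set) \<Rightarrow> bool" where
  "prime_chain R n P \<longleftrightarrow> (\<forall>i\<le>n. primeideal (P i) R) \<and> (\<forall>i<n. P i \<subset> P (Suc i))"

(* The supremum of the lengths n of chains P 0 \<subset> ... \<subset> P n of prime ideals.  The supremum
   of the empty set is 0 in enat, so the zero ring gets dimension 0 here. *)
definition krull_dim :: "('a, 'b) ring_scheme \<Rightarrow> enat" where
  "krull_dim R = Sup {enat n |n. \<exists>P. prime_chain R n P}"

definition zero_dimensional :: "('a, 'b) ring_scheme \<Rightarrow> bool" where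
  "zero_dimensional R \<longleftrightarrow> krull_dim R = 0"

definition multiplicative_set :: "('a, 'b) ring_scheme \<Rightarrow> 'a set \<Rightarrow> bool" where
  "multiplicative_set R S \<longleftrightarrow> submonoid S R \<and> \<zero>\<^bsub>R\<^esub> \<notin> S"

definition strongly_multiplicative :: "('a, 'b) ring_scheme \<Rightarrow> 'a set \<Rightarrow> bool" where
  "strongly_multiplicative R S \<longleftrightarrow>
     multiplicative_set R S \<and>
     (\<forall>A\<subseteq>S. (carrier R \<inter> (\<Inter>s\<in>A. PIdl\<^bsub>R\<^esub> s)) \<inter> S \<noteq> {})"


definition fraction_rel :: "('a, 'b) ring_scheme \<Rightarrow> 'a set \<Rightarrow> (('a \<times> 'a) \<times> ('a \<times> 'a)) set" where
  "fraction_rel R S =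
     {((a, s), (b, t)) |a s b t.
        a \<in> carrier R \<and> s \<in> S \<and> b \<in> carrier R \<and> t \<in> S \<and>
        (\<exists>u\<in>S. u \<otimes>\<^bsub>R\<^esub> ((a \<otimes>\<^bsub>R\<^esub> t) \<ominus>\<^bsub>R\<^esub> (b \<otimes>\<^bsub>R\<^esub> s)) = \<zero>\<^bsub>R\<^esub>)}"

definition fraction :: "('a, 'b) ring_scheme \<Rightarrow> 'a set \<Rightarrow> 'a \<Rightarrow> 'a \<Rightarrow> ('a \<times> 'a) set" where
  "fraction R S a s = fraction_rel R S `` {(a, s)}"

(* The operations act on classes; a union over all representatives is the common value, since
   the operations are compatible with fraction_rel (see mult_fraction and add_fraction). *)
definition localization :: "('a, 'b) ring_scheme \<Rightarrow> 'a set \<Rightarrow> ('a \<times> 'a) set ring" where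
  "localization R S =
     \<lparr> carrier = (carrier R \<times> S) // fraction_rel R S,
       monoid.mult = (\<lambda>x y. \<Union>(a, s)\<in>x. \<Union>(b, t)\<in>y. fraction R S (a \<otimes>\<^bsub>R\<^esub> b) (s \<otimes>\<^bsub>R\<^esub> t)),
       monoid.one = fraction R S \<one>\<^bsub>R\<^esub> \<one>\<^bsub>R\<^esub>,
       ring.zero = fraction R S \<zero>\<^bsub>R\<^esub> \<one>\<^bsub>R\<^esub>,
       ring.add = (\<lambda>x y. \<Union>(a, s)\<in>x. \<Union>(b, t)\<in>y.
                fraction R S ((a \<otimes>\<^bsub>R\<^esub> t) \<oplus>\<^bsub>R\<^esub> (b \<otimes>\<^bsub>R\<^esub> s)) (s \<otimes>\<^bsub>R\<^esub> t)) \<rparr>"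

definition localize_ideal :: "('a, 'b) ring_scheme \<Rightarrow> 'a set \<Rightarrow> 'a set \<Rightarrow> ('a \<times> 'a) set set" where
  "localize_ideal R S I = {fraction R S a s |a s. a \<in> I \<and> s \<in> S}"

definition localization_commutes_with_Inter :: "('a, 'b) ring_scheme \<Rightarrow> 'a set \<Rightarrow> bool" where
  "localization_commutes_with_Inter R P \<longleftrightarrow>
     (\<forall>F. (\<forall>I\<in>F. ideal I R) \<longrightarrow>
        localize_ideal R (carrier R - P) (carrier R \<inter> \<Inter>F) =
        carrier (localization R (carrier R - P)) \<inter>
          (\<Inter>I\<in>F. localize_ideal R (carrier R - P) I))"


lemma UN2_eq_const:
  assumes "(a, s) \<in> A" "(b, t) \<in> B"
    and eq: "\<And>c p d q. (c, p) \<in> A \<Longrightarrow> (d, q) \<in> B \<Longrightarrow> f c p d q = K"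
  shows "(\<Union>(c, p)\<in>A. \<Union>(d, q)\<in>B. f c p d q) = K"
proof
  show "(\<Union>(c, p)\<in>A. \<Union>(d, q)\<in>B. f c p d q) \<subseteq> K"
    by (intro UN_least) (auto dest: eq)
  show "K \<subseteq> (\<Union>(c, p)\<in>A. \<Union>(d, q)\<in>B. f c p d q)"
    using assms(1,2) eq[OF assms(1,2)] by blast
qed

context cring
begin

context
  fixes S
  assumes S: "submonoid S R"
begin

lemma S_carr: "s \<in> S \<Longrightarrow> s \<in> carrier R"
  using submonoid.subset[OF S] by blast

lemma S_mult: "s \<in> S \<Longrightarrow> t \<in> S \<Longrightarrow> s \<otimes> t \<in> S"
  using submonoid.m_closed[OF S] by blast

lemma S_one: "\<one> \<in> S"
  using submonoid.one_closed[OF S] by blast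

lemma fraction_rel_iff:
  "((a, s), (b, t)) \<in> fraction_rel R S \<longleftrightarrow>
     a \<in> carrier R \<and> s \<in> S \<and> b \<in> carrier R \<and> t \<in> S \<and>
     (\<exists>u\<in>S. u \<otimes> ((a \<otimes> t) \<ominus> (b \<otimes> s)) = \<zero>)"
  by (auto simp: fraction_rel_def)

lemma fraction_relI:
  assumes "a \<in> carrier R" "s \<in> S" "b \<in> carrier R" "t \<in> S" "a \<otimes> t = b \<otimes> s"
  shows "((a, s), (b, t)) \<in> fraction_rel R S"
  using assms S_one S_carr unfolding fraction_rel_iff
  by (intro conjI bexI[of _ \<one>]) (auto simp: r_neg minus_eq)

lemma equiv_fraction_rel: "equiv (carrier R \<times> S) (fraction_rel R S)"
proof (rule equivI)
  show "fraction_rel R S \<subseteq> (carrier R \<times> S) \<times> (carrier R \<times> S)"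
    by (auto simp: fraction_rel_def)
  show "refl_on (carrier R \<times> S) (fraction_rel R S)"
    by (auto simp: refl_on_def intro: fraction_relI)
  show "sym (fraction_rel R S)"
  proof (rule symI, clarify)
    fix a s b t assume "((a, s), (b, t)) \<in> fraction_rel R S"
    then obtain u where
      c: "a \<in> carrier R" "s \<in> S" "b \<in> carrier R" "t \<in> S" "u \<in> S" and
      e: "u \<otimes> ((a \<otimes> t) \<ominus> (b \<otimes> s)) = \<zero>"
      by (auto simp: fraction_rel_iff)
    have c': "s \<in> carrier R" "t \<in> carrier R" "u \<in> carrier R" using c S_carr by auto
    have "u \<otimes> ((b \<otimes> s) \<ominus> (a \<otimes> t)) = \<ominus> (u \<otimes> ((a \<otimes> t) \<ominus> (b \<otimes> s)))"
      using c c' by algebra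
    then show "((b, t), (a, s)) \<in> fraction_rel R S"
      using c e by (auto simp: fraction_rel_iff)
  qed
  show "trans (fraction_rel R S)"
  proof (rule transI, clarify)
    fix a s b t d w
    assume "((a, s), (b, t)) \<in> fraction_rel R S" "((b, t), (d, w)) \<in> fraction_rel R S"
    then obtain u v where
      c: "a \<in> carrier R" "s \<in> S" "b \<in> carrier R" "t \<in> S" "d \<in> carrier R" "w \<in> S" "u \<in> S" "v \<in> S" and
      e: "u \<otimes> ((a \<otimes> t) \<ominus> (b \<otimes> s)) = \<zero>" "v \<otimes> ((b \<otimes> w) \<ominus> (d \<otimes> t)) = \<zero>"
      by (auto simp: fraction_rel_iff)
    have c': "s \<in> carrier R" "t \<in> carrier R" "w \<in> carrier R" "u \<in> carrier R" "v \<in> carrier R"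
      using c S_carr by auto
    have "(u \<otimes> v \<otimes> t) \<otimes> ((a \<otimes> w) \<ominus> (d \<otimes> s)) =
      v \<otimes> w \<otimes> (u \<otimes> ((a \<otimes> t) \<ominus> (b \<otimes> s))) \<oplus> u \<otimes> s \<otimes> (v \<otimes> ((b \<otimes> w) \<ominus> (d \<otimes> t)))"
      using c c' by algebra
    also have "\<dots> = \<zero>" unfolding e using c' by simp
    finally show "((a, s), (d, w)) \<in> fraction_rel R S"
      using c S_mult by (auto simp: fraction_rel_iff)
  qed
qed

lemma fraction_eq_iff:
  assumes "a \<in> carrier R" "s \<in> S" "b \<in> carrier R" "t \<in> S"
  shows "fraction R S a s = fraction R S b t \<longleftrightarrow> (\<exists>u\<in>S. u \<otimes> ((a \<otimes> t) \<ominus> (b \<otimes> s)) = \<zero>)"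
  using eq_equiv_class_iff[OF equiv_fraction_rel, of "(a, s)" "(b, t)"] assms
  by (simp add: fraction_def fraction_rel_iff)

lemma fraction_eqI:
  assumes "a \<in> carrier R" "s \<in> S" "b \<in> carrier R" "t \<in> S" "a \<otimes> t = b \<otimes> s"
  shows "fraction R S a s = fraction R S b t"
  unfolding fraction_def by (rule equiv_class_eq[OF equiv_fraction_rel fraction_relI]) fact+

lemma carrier_localization:
  "carrier (localization R S) = {fraction R S a s |a s. a \<in> carrier R \<and> s \<in> S}"
  by (auto simp: localization_def quotient_def fraction_def)

lemma fraction_closed: "a \<in> carrier R \<Longrightarrow> s \<in> S \<Longrightarrow> fraction R S a s \<in> carrier (localization R S)"
  by (auto simp: carrier_localization)

lemma mult_fraction:
  assumes "a \<in> carrier R" "s \<in> S" "b \<in> carrier R" "t \<in> S"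
  shows "fraction R S a s \<otimes>\<^bsub>localization R S\<^esub> fraction R S b t = fraction R S (a \<otimes> b) (s \<otimes> t)"
proof -
  have eq: "fraction R S (a \<otimes> b) (s \<otimes> t) = fraction R S (c \<otimes> d) (p \<otimes> q)"
    if "((a, s), (c, p)) \<in> fraction_rel R S" "((b, t), (d, q)) \<in> fraction_rel R S" for c d p q
  proof -
    from that obtain u v where
      c: "c \<in> carrier R" "d \<in> carrier R" "p \<in> S" "q \<in> S" "u \<in> S" "v \<in> S" and
      e: "u \<otimes> ((a \<otimes> p) \<ominus> (c \<otimes> s)) = \<zero>" "v \<otimes> ((b \<otimes> q) \<ominus> (d \<otimes> t)) = \<zero>"
      by (auto simp: fraction_rel_iff)
    have c': "s \<in> carrier R" "t \<in> carrier R" "p \<in> carrier R" "q \<in> carrier R"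
      "u \<in> carrier R" "v \<in> carrier R"
      using c assms S_carr by auto
    have "(u \<otimes> v) \<otimes> ((a \<otimes> b \<otimes> (p \<otimes> q)) \<ominus> (c \<otimes> d \<otimes> (s \<otimes> t))) =
      v \<otimes> b \<otimes> q \<otimes> (u \<otimes> ((a \<otimes> p) \<ominus> (c \<otimes> s))) \<oplus> u \<otimes> c \<otimes> s \<otimes> (v \<otimes> ((b \<otimes> q) \<ominus> (d \<otimes> t)))"
      using assms c c' by algebra
    also have "\<dots> = \<zero>" unfolding e using c c' assms by simp
    finally show ?thesis using assms c S_mult by (subst fraction_eq_iff) auto
  qed
  have mem: "(a, s) \<in> fraction R S a s" "(b, t) \<in> fraction R S b t"
    using assms by (auto simp: fraction_def intro: fraction_relI)
  have "fraction R S a s \<otimes>\<^bsub>localization R S\<^esub> fraction R S b t =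
    (\<Union>(c, p)\<in>fraction R S a s. \<Union>(d, q)\<in>fraction R S b t. fraction R S (c \<otimes> d) (p \<otimes> q))"
    by (simp add: localization_def)
  also have "\<dots> = fraction R S (a \<otimes> b) (s \<otimes> t)"
  proof (rule UN2_eq_const[OF mem])
    fix c p d q
    assume "(c, p) \<in> fraction R S a s" "(d, q) \<in> fraction R S b t"
    then have "((a, s), (c, p)) \<in> fraction_rel R S" "((b, t), (d, q)) \<in> fraction_rel R S"
      by (simp_all add: fraction_def)
    then show "fraction R S (c \<otimes> d) (p \<otimes> q) = fraction R S (a \<otimes> b) (s \<otimes> t)"
      by (rule eq[symmetric])
  qed
  finally show ?thesis .
qed

lemma add_fraction:
  assumes "a \<in> carrier R" "s \<in> S" "b \<in> carrier R" "t \<in> S"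
  shows "fraction R S a s \<oplus>\<^bsub>localization R S\<^esub> fraction R S b t = fraction R S (a \<otimes> t \<oplus> b \<otimes> s) (s \<otimes> t)"
proof -
  have eq: "fraction R S (a \<otimes> t \<oplus> b \<otimes> s) (s \<otimes> t) = fraction R S (c \<otimes> q \<oplus> d \<otimes> p) (p \<otimes> q)"
    if "((a, s), (c, p)) \<in> fraction_rel R S" "((b, t), (d, q)) \<in> fraction_rel R S" for c d p q
  proof -
    from that obtain u v where
      c: "c \<in> carrier R" "d \<in> carrier R" "p \<in> S" "q \<in> S" "u \<in> S" "v \<in> S" and
      e: "u \<otimes> ((a \<otimes> p) \<ominus> (c \<otimes> s)) = \<zero>" "v \<otimes> ((b \<otimes> q) \<ominus> (d \<otimes> t)) = \<zero>"
      by (auto simp: fraction_rel_iff)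
    have c': "s \<in> carrier R" "t \<in> carrier R" "p \<in> carrier R" "q \<in> carrier R"
      "u \<in> carrier R" "v \<in> carrier R"
      using c assms S_carr by auto
    have "(u \<otimes> v) \<otimes> (((a \<otimes> t \<oplus> b \<otimes> s) \<otimes> (p \<otimes> q)) \<ominus> ((c \<otimes> q \<oplus> d \<otimes> p) \<otimes> (s \<otimes> t))) =
      v \<otimes> t \<otimes> q \<otimes> (u \<otimes> ((a \<otimes> p) \<ominus> (c \<otimes> s))) \<oplus> u \<otimes> s \<otimes> p \<otimes> (v \<otimes> ((b \<otimes> q) \<ominus> (d \<otimes> t)))"
      using assms c c' by algebra
    also have "\<dots> = \<zero>" unfolding e using c c' assms by simp
    finally show ?thesis using assms c c' S_mult by (subst fraction_eq_iff) auto
  qed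
  have mem: "(a, s) \<in> fraction R S a s" "(b, t) \<in> fraction R S b t"
    using assms by (auto simp: fraction_def intro: fraction_relI)
  have "fraction R S a s \<oplus>\<^bsub>localization R S\<^esub> fraction R S b t =
    (\<Union>(c, p)\<in>fraction R S a s. \<Union>(d, q)\<in>fraction R S b t. fraction R S (c \<otimes> q \<oplus> d \<otimes> p) (p \<otimes> q))"
    by (simp add: localization_def)
  also have "\<dots> = fraction R S (a \<otimes> t \<oplus> b \<otimes> s) (s \<otimes> t)"
  proof (rule UN2_eq_const[OF mem])
    fix c p d q
    assume "(c, p) \<in> fraction R S a s" "(d, q) \<in> fraction R S b t"
    then have "((a, s), (c, p)) \<in> fraction_rel R S" "((b, t), (d, q)) \<in> fraction_rel R S"
      by (simp_all add: fraction_def)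
    then show "fraction R S (c \<otimes> q \<oplus> d \<otimes> p) (p \<otimes> q) = fraction R S (a \<otimes> t \<oplus> b \<otimes> s) (s \<otimes> t)"
      by (rule eq[symmetric])
  qed
  finally show ?thesis .
qed

lemma zero_localization: "\<zero>\<^bsub>localization R S\<^esub> = fraction R S \<zero> \<one>"
  and one_localization: "\<one>\<^bsub>localization R S\<^esub> = fraction R S \<one> \<one>"
  by (simp_all add: localization_def)

lemma cring_localization: "cring (localization R S)"
proof (rule cringI)
  note [simp] = S_one S_mult S_carr mult_fraction add_fraction zero_localization one_localization fraction_closed
  let ?L = "localization R S"
  have ex: "\<exists>a s. a \<in> carrier R \<and> s \<in> S \<and> x = fraction R S a s" if "x \<in> carrier ?L" for x
    using that by (auto simp: carrier_localization)
  show "abelian_group ?L"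
  proof (rule abelian_groupI)
    fix x y assume "x \<in> carrier ?L" "y \<in> carrier ?L"
    then obtain a s b t where xy: "a \<in> carrier R" "s \<in> S" "x = fraction R S a s"
      "b \<in> carrier R" "t \<in> S" "y = fraction R S b t" using ex by metis
    then show "x \<oplus>\<^bsub>?L\<^esub> y \<in> carrier ?L" by simp
    have c: "s \<in> carrier R" "t \<in> carrier R" using xy by auto
    show "x \<oplus>\<^bsub>?L\<^esub> y = y \<oplus>\<^bsub>?L\<^esub> x"
    proof -
      have "(a \<otimes> t \<oplus> b \<otimes> s) \<otimes> (t \<otimes> s) = (b \<otimes> s \<oplus> a \<otimes> t) \<otimes> (s \<otimes> t)"
        using xy(1,4) c by algebra
      then show ?thesis using xy by (simp, intro fraction_eqI) auto
    qed
  next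
    fix x y z assume "x \<in> carrier ?L" "y \<in> carrier ?L" "z \<in> carrier ?L"
    then obtain a s b t d w where xyz: "a \<in> carrier R" "s \<in> S" "x = fraction R S a s"
      "b \<in> carrier R" "t \<in> S" "y = fraction R S b t" "d \<in> carrier R" "w \<in> S" "z = fraction R S d w"
      using ex[of x] ex[of y] ex[of z] by blast
    have c: "s \<in> carrier R" "t \<in> carrier R" "w \<in> carrier R" using xyz by auto
    have "((a \<otimes> t \<oplus> b \<otimes> s) \<otimes> w \<oplus> d \<otimes> (s \<otimes> t)) \<otimes> (s \<otimes> (t \<otimes> w)) =
      (a \<otimes> (t \<otimes> w) \<oplus> (b \<otimes> w \<oplus> d \<otimes> t) \<otimes> s) \<otimes> ((s \<otimes> t) \<otimes> w)"
      using xyz(1,4,7) c by algebra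
    then show "(x \<oplus>\<^bsub>?L\<^esub> y) \<oplus>\<^bsub>?L\<^esub> z = x \<oplus>\<^bsub>?L\<^esub> (y \<oplus>\<^bsub>?L\<^esub> z)"
      using xyz by (simp, intro fraction_eqI) auto
  next
    show "\<zero>\<^bsub>?L\<^esub> \<in> carrier ?L" by simp
  next
    fix x assume "x \<in> carrier ?L"
    then obtain a s where x: "a \<in> carrier R" "s \<in> S" "x = fraction R S a s" using ex by metis
    show "\<zero>\<^bsub>?L\<^esub> \<oplus>\<^bsub>?L\<^esub> x = x" using x by simp
    have "(\<ominus> a \<otimes> s \<oplus> a \<otimes> s) \<otimes> \<one> = \<zero> \<otimes> (s \<otimes> s)"
      using x(1) S_carr[OF x(2)] by algebra
    then have "fraction R S (\<ominus> a) s \<oplus>\<^bsub>?L\<^esub> x = \<zero>\<^bsub>?L\<^esub>"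
      using x by (simp, intro fraction_eqI) auto
    then show "\<exists>y\<in>carrier ?L. y \<oplus>\<^bsub>?L\<^esub> x = \<zero>\<^bsub>?L\<^esub>"
      using x by (intro bexI[of _ "fraction R S (\<ominus> a) s"]) auto
  qed
  show "comm_monoid ?L"
  proof (rule comm_monoidI)
    fix x y assume "x \<in> carrier ?L" "y \<in> carrier ?L"
    then obtain a s b t where xy: "a \<in> carrier R" "s \<in> S" "x = fraction R S a s"
      "b \<in> carrier R" "t \<in> S" "y = fraction R S b t" using ex by metis
    then show "x \<otimes>\<^bsub>?L\<^esub> y \<in> carrier ?L" by simp
    show "x \<otimes>\<^bsub>?L\<^esub> y = y \<otimes>\<^bsub>?L\<^esub> x" using xy by (simp add: m_comm)
  next
    fix x y z assume "x \<in> carrier ?L" "y \<in> carrier ?L" "z \<in> carrier ?L"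
    then obtain a s b t d w where xyz: "a \<in> carrier R" "s \<in> S" "x = fraction R S a s"
      "b \<in> carrier R" "t \<in> S" "y = fraction R S b t" "d \<in> carrier R" "w \<in> S" "z = fraction R S d w"
      using ex[of x] ex[of y] ex[of z] by blast
    then show "(x \<otimes>\<^bsub>?L\<^esub> y) \<otimes>\<^bsub>?L\<^esub> z = x \<otimes>\<^bsub>?L\<^esub> (y \<otimes>\<^bsub>?L\<^esub> z)" by (simp add: m_assoc)
  next
    show "\<one>\<^bsub>?L\<^esub> \<in> carrier ?L" by simp
  next
    fix x assume "x \<in> carrier ?L"
    then obtain a s where x: "a \<in> carrier R" "s \<in> S" "x = fraction R S a s" using ex by metis
    then show "\<one>\<^bsub>?L\<^esub> \<otimes>\<^bsub>?L\<^esub> x = x" by simp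
  qed
  fix x y z assume "x \<in> carrier ?L" "y \<in> carrier ?L" "z \<in> carrier ?L"
  then obtain a s b t d w where xyz: "a \<in> carrier R" "s \<in> S" "x = fraction R S a s"
    "b \<in> carrier R" "t \<in> S" "y = fraction R S b t" "d \<in> carrier R" "w \<in> S" "z = fraction R S d w"
    using ex[of x] ex[of y] ex[of z] by blast
  have c: "s \<in> carrier R" "t \<in> carrier R" "w \<in> carrier R" using xyz by auto
  have "((a \<otimes> t \<oplus> b \<otimes> s) \<otimes> d) \<otimes> (s \<otimes> w \<otimes> (t \<otimes> w)) =
    (a \<otimes> d \<otimes> (t \<otimes> w) \<oplus> b \<otimes> d \<otimes> (s \<otimes> w)) \<otimes> (s \<otimes> t \<otimes> w)"
    using xyz(1,4,7) c by algebra
  then show "(x \<oplus>\<^bsub>?L\<^esub> y) \<otimes>\<^bsub>?L\<^esub> z = x \<otimes>\<^bsub>?L\<^esub> z \<oplus>\<^bsub>?L\<^esub> y \<otimes>\<^bsub>?L\<^esub> z"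
    using xyz by (simp, intro fraction_eqI) auto
qed

end

end

end

theory Submission
  imports Defs
begin

text \<open>
  Conditions (1), (2) and (3) are equivalent prime by prime. For (1) and (2) one passes between
  ideals not contained in \<open>P\<close> and elements outside \<open>P\<close>; for (3), a common multiple outside \<open>P\<close>
  of arbitrarily many elements outside \<open>P\<close> serves as a common denominator.

  If \<open>P\<close> is strongly prime, some \<open>t \<notin> P\<close> is a multiple of every element outside \<open>P\<close>. For
  \<open>x \<notin> P\<close> this applies to \<open>t x\<close>, so \<open>t (1 - r x) = 0\<close> for some \<open>r\<close>, and \<open>x\<close> is a unit modulo
  \<open>P\<close>: hence dimension zero. The elements lying in all but finitely many maximal ideals form an
  ideal, which for strongly prime maximal ideals is contained in none of them; it therefore
  contains 1, so there are only finitely many maximal ideals.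

  Conversely, let the primes be finitely many and pairwise incomparable. Choose \<open>x \<notin> P\<close> in all
  other primes and write \<open>1 = v + w\<close> with \<open>v \<in> P\<close> and \<open>w\<close> a multiple of \<open>x\<close>. Then \<open>w v\<close> lies in
  every prime, so \<open>w^n v^n = 0\<close> for some \<open>n\<close>, and \<open>w^n \<notin> P\<close> lies in every ideal not contained
  in \<open>P\<close>.
\<close>

section \<open>Prime and maximal ideals from Zorn's lemma\<close>

context cring
begin

text \<open>One Zorn argument serves twice: a submonoid \<open>S\<close> will yield prime ideals,
  and \<open>S = {\<one>}\<close> maximal ones.\<close>

lemma exists_maximal_disjoint_ideal:
  assumes "ideal I R" and "I \<inter> S = {}"
  shows "\<exists>M. ideal M R \<and> I \<subseteq> M \<and> M \<inter> S = {} \<and>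
    (\<forall>J. ideal J R \<longrightarrow> M \<subset> J \<longrightarrow> J \<inter> S \<noteq> {})"
proof -
  define A where "A = {J. ideal J R \<and> I \<subseteq> J \<and> J \<inter> S = {}}"
  have "\<exists>M\<in>A. \<forall>J\<in>A. M \<subseteq> J \<longrightarrow> J = M"
  proof (rule subset_Zorn_nonempty)
    show "A \<noteq> {}" using assms by (auto simp: A_def)
    fix C assume C: "C \<noteq> {}" "subset.chain A C"
    then have "subset.chain {J. ideal J R} C" by (auto simp: subset_chain_def A_def)
    from chain_Union_is_ideal[OF this] C show "\<Union>C \<in> A"
      by (auto simp: subset_chain_def A_def)
  qed
  then obtain M where "M \<in> A" "\<forall>J\<in>A. M \<subseteq> J \<longrightarrow> J = M" by blast
  then show ?thesis unfolding A_def by (intro exI[of _ M]) blast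
qed

lemma ideal_add_PIdl:
  assumes "ideal I R" and "x \<in> carrier R"
  shows "ideal (I <+>\<^bsub>R\<^esub> PIdl x) R" "I \<subseteq> I <+>\<^bsub>R\<^esub> PIdl x" "x \<in> I <+>\<^bsub>R\<^esub> PIdl x"
proof -
  show "ideal (I <+>\<^bsub>R\<^esub> PIdl x) R" using assms by (intro add_ideals cgenideal_ideal)
  interpret I: ideal I R by fact
  have "i \<oplus> \<zero> \<otimes> x \<in> I <+>\<^bsub>R\<^esub> PIdl x" if "i \<in> I" for i
    using that unfolding set_add_def' cgenideal_def by blast
  then show "I \<subseteq> I <+>\<^bsub>R\<^esub> PIdl x" using assms I.Icarr by auto
  have "\<zero> \<oplus> \<one> \<otimes> x \<in> I <+>\<^bsub>R\<^esub> PIdl x"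
    using I.zero_closed unfolding set_add_def' cgenideal_def by blast
  then show "x \<in> I <+>\<^bsub>R\<^esub> PIdl x" using assms by simp
qed

lemma mem_ideal_add_PIdlE:
  assumes "y \<in> I <+>\<^bsub>R\<^esub> PIdl x"
  obtains i r where "i \<in> I" "r \<in> carrier R" "y = i \<oplus> r \<otimes> x"
  using assms unfolding set_add_def' cgenideal_def by blast

text \<open>An ideal maximal among those avoiding \<open>S\<close> is prime: enlarging it by
  \<open>a\<close> or by \<open>b\<close> makes it meet \<open>S\<close>, and the product of the two
  elements met lies in \<open>S\<close>, yet also in \<open>P\<close> as soon as
  \<open>a \<otimes> b\<close> does.\<close>

lemma exists_primeideal_disjoint:
  assumes "ideal I R" and S: "submonoid S R" and "I \<inter> S = {}"
  shows "\<exists>P. primeideal P R \<and> I \<subseteq> P \<and> P \<inter> S = {}"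
proof -
  obtain P where P: "ideal P R" "I \<subseteq> P" "P \<inter> S = {}"
    and max: "\<And>J. ideal J R \<Longrightarrow> P \<subset> J \<Longrightarrow> J \<inter> S \<noteq> {}"
    using exists_maximal_disjoint_ideal[OF assms(1,3)] by blast
  interpret P: ideal P R by fact
  have meets: "\<exists>i r. i \<in> P \<and> r \<in> carrier R \<and> i \<oplus> r \<otimes> a \<in> S"
    if "a \<in> carrier R" "a \<notin> P" for a
  proof -
    have "(P <+>\<^bsub>R\<^esub> PIdl a) \<inter> S \<noteq> {}"
      using that ideal_add_PIdl[OF P(1), of a] by (intro max) auto
    then obtain y where "y \<in> P <+>\<^bsub>R\<^esub> PIdl a" "y \<in> S" by blast
    then show ?thesis by (auto elim!: mem_ideal_add_PIdlE)
  qed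
  have "primeideal P R"
  proof (rule primeidealI[OF P(1) is_cring])
    show "carrier R \<noteq> P" using P(3) submonoid.one_closed[OF S] by auto
    fix a b assume ab: "a \<in> carrier R" "b \<in> carrier R" "a \<otimes> b \<in> P"
    show "a \<in> P \<or> b \<in> P"
    proof (rule ccontr)
      assume "\<not> (a \<in> P \<or> b \<in> P)"
      then have "a \<notin> P" "b \<notin> P" by auto
      from meets[OF ab(1) this(1)] meets[OF ab(2) this(2)] obtain i r j q where
        c: "i \<in> P" "r \<in> carrier R" "j \<in> P" "q \<in> carrier R" and
        s: "i \<oplus> r \<otimes> a \<in> S" "j \<oplus> q \<otimes> b \<in> S"
        by blast
      have c': "i \<in> carrier R" "j \<in> carrier R" using c P.Icarr by auto
      \<comment> \<open>The expanded product is grouped so that each summand is a multiple of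
        \<open>i\<close>, \<open>j\<close> or \<open>a \<otimes> b\<close>.\<close>
      have "(i \<oplus> r \<otimes> a) \<otimes> (j \<oplus> q \<otimes> b) =
        (j \<oplus> q \<otimes> b) \<otimes> i \<oplus> ((r \<otimes> a) \<otimes> j \<oplus> (r \<otimes> q) \<otimes> (a \<otimes> b))"
        using c c' ab by algebra
      also have "\<dots> \<in> P"
        using c c' ab
        by (intro P.a_closed P.I_l_closed[of i] P.I_l_closed[of j] P.I_l_closed[of "a \<otimes> b"]) auto
      finally show False
        using submonoid.m_closed[OF S s] P(3) by blast
    qed
  qed
  with P show ?thesis by blast
qed

lemma exists_primeideal:
  assumes "ideal I R" and "\<one> \<notin> I"
  shows "\<exists>P. primeideal P R \<and> I \<subseteq> P"
proof -
  have "submonoid {\<one>} R" by unfold_locales auto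
  from exists_primeideal_disjoint[OF assms(1) this] assms(2) show ?thesis by auto
qed

text \<open>An ideal is proper iff it avoids \<open>\<one>\<close>, so maximality among ideals
  disjoint from \<open>{\<one>}\<close> is ordinary maximality.\<close>

lemma exists_maximalideal:
  assumes "ideal I R" and "\<one> \<notin> I"
  shows "\<exists>M. maximalideal M R \<and> I \<subseteq> M"
proof -
  obtain M where M: "ideal M R" "I \<subseteq> M" "M \<inter> {\<one>} = {}"
    and max: "\<And>J. ideal J R \<Longrightarrow> M \<subset> J \<Longrightarrow> J \<inter> {\<one>} \<noteq> {}"
    using exists_maximal_disjoint_ideal[OF assms(1), of "{\<one>}"] assms(2) by auto
  have "maximalideal M R"
  proof (rule maximalidealI[OF M(1)])
    show "carrier R \<noteq> M" using M(3) by auto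
    fix J assume "ideal J R" "M \<subseteq> J"
    then show "J = M \<or> J = carrier R"
      using max[of J] ideal.one_imp_carrier[of J R] by blast
  qed
  with M show ?thesis by blast
qed

text \<open>If no power of \<open>a\<close> vanished, the powers would form a submonoid disjoint
  from the zero ideal, and some prime would avoid them all, including \<open>a\<close>.\<close>

lemma nilpotent_if_mem_all_primes:
  assumes a: "a \<in> carrier R" and mem: "\<And>P. primeideal P R \<Longrightarrow> a \<in> P"
  shows "\<exists>n::nat. a [^] n = \<zero>"
proof (rule ccontr)
  assume nz: "\<not> (\<exists>n::nat. a [^] n = \<zero>)"
  let ?S = "range (\<lambda>n::nat. a [^] n)"
  have "submonoid ?S R"
  proof
    show "?S \<subseteq> carrier R" using a by auto
    show "x \<otimes> y \<in> ?S" if "x \<in> ?S" "y \<in> ?S" for x y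
      using that a by (auto simp: nat_pow_mult)
    show "\<one> \<in> ?S" by (rule range_eqI[of _ _ 0]) simp
  qed
  moreover have "{\<zero>} \<inter> ?S = {}" using nz by (metis disjoint_iff imageE singletonD)
  ultimately obtain P where "primeideal P R" "P \<inter> ?S = {}"
    using exists_primeideal_disjoint[OF zeroideal] by blast
  moreover have "a \<in> ?S" using a by (intro range_eqI[of _ _ "1::nat"]) simp
  ultimately show False using mem by blast
qed

lemma primeideal_one_notin:
  assumes "primeideal P R"
  shows "\<one> \<notin> P"
proof -
  interpret primeideal P R by fact
  show ?thesis using one_imp_carrier I_notcarr by auto
qed

lemma primeideal_nat_pow:
  assumes "primeideal P R" and "a \<in> carrier R" and "a [^] (n::nat) \<in> P"
  shows "a \<in> P"
  using assms(3)
proof (induction n)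
  case 0
  then show ?case using primeideal_one_notin[OF assms(1)] by simp
next
  case (Suc n)
  then show ?case using primeideal.I_prime[OF assms(1), of "a [^] n" a] assms(2) by auto
qed

section \<open>Strong primeness at a single prime\<close>

lemma multiplicative_set_compl_primeideal:
  assumes "primeideal P R"
  shows "multiplicative_set R (carrier R - P)"
proof -
  interpret P: primeideal P R by fact
  have "submonoid (carrier R - P) R"
    using primeideal_one_notin[OF assms] by unfold_locales (auto dest: P.I_prime)
  then show ?thesis using P.zero_closed by (auto simp: multiplicative_set_def)
qed

lemma strongly_multiplicativeD:
  assumes "strongly_multiplicative R S" and "A \<subseteq> S"
  shows "\<exists>t\<in>S. \<forall>s\<in>A. t \<in> PIdl s"
proof -
  have "carrier R \<inter> (\<Inter>s\<in>A. PIdl s) \<inter> S \<noteq> {}"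
    using assms by (simp add: strongly_multiplicative_def)
  then show ?thesis by auto
qed

text \<open>Principal ideals link the two sides: for \<open>s\<close> in the ring,
  \<open>PIdl s\<close> lies in \<open>P\<close> iff \<open>s\<close> does, and an ideal not inside
  \<open>P\<close> contains \<open>PIdl s\<close> for some \<open>s\<close> outside
  \<open>P\<close>.\<close>

lemma strongly_prime_iff_strongly_multiplicative:
  assumes "primeideal P R"
  shows "strongly_prime R P \<longleftrightarrow> strongly_multiplicative R (carrier R - P)"
proof
  assume sp: "strongly_prime R P"
  have "carrier R \<inter> (\<Inter>s\<in>A. PIdl s) \<inter> (carrier R - P) \<noteq> {}" if A: "A \<subseteq> carrier R - P" for A
  proof
    assume "carrier R \<inter> (\<Inter>s\<in>A. PIdl s) \<inter> (carrier R - P) = {}"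
    then have "carrier R \<inter> \<Inter>((\<lambda>s. PIdl s) ` A) \<subseteq> P" by blast
    moreover have "\<forall>I\<in>(\<lambda>s. PIdl s) ` A. ideal I R" using A cgenideal_ideal by auto
    ultimately obtain s where "s \<in> A" "PIdl s \<subseteq> P"
      using sp unfolding strongly_prime_def by (metis (no_types, lifting) imageE)
    then show False using A cgenideal_self by blast
  qed
  then show "strongly_multiplicative R (carrier R - P)"
    using multiplicative_set_compl_primeideal[OF assms]
    by (simp add: strongly_multiplicative_def)
next
  assume sm: "strongly_multiplicative R (carrier R - P)"
  have "\<exists>I\<in>F. I \<subseteq> P" if F: "\<forall>I\<in>F. ideal I R" "carrier R \<inter> \<Inter>F \<subseteq> P" for F
  proof (rule ccontr)
    assume n: "\<not> (\<exists>I\<in>F. I \<subseteq> P)"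
    \<comment> \<open>Taking every element outside \<open>P\<close> of every member of
      \<open>F\<close> avoids choosing one per ideal.\<close>
    let ?A = "{s \<in> carrier R - P. \<exists>I\<in>F. s \<in> I}"
    have "?A \<subseteq> carrier R - P" by blast
    from strongly_multiplicativeD[OF sm this]
    obtain t where t: "t \<in> carrier R - P" "\<And>s. s \<in> ?A \<Longrightarrow> t \<in> PIdl s" by blast
    have "t \<in> I" if "I \<in> F" for I
    proof -
      interpret ideal I R using F that by blast
      obtain s where s: "s \<in> I" "s \<notin> P" using n \<open>I \<in> F\<close> by blast
      with t(2)[of s] that have "t \<in> PIdl s" using Icarr by blast
      then show ?thesis using cgenideal_minimal[OF is_ideal s(1)] by blast
    qed
    then show False using t F by blast
  qed
  with assms show "strongly_prime R P" unfolding strongly_prime_def by blast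
qed

lemma strongly_prime_iff_localization_commutes:
  assumes P: "primeideal P R"
  shows "strongly_prime R P \<longleftrightarrow> localization_commutes_with_Inter R P"
proof -
  let ?S = "carrier R - P"
  have S: "submonoid ?S R"
    using multiplicative_set_compl_primeideal[OF P] by (simp add: multiplicative_set_def)
  interpret P: primeideal P R by fact
  note Sc = S_carr[OF S] and Sm = S_mult[OF S] and S1 = S_one[OF S]
  show ?thesis
  proof
    assume "strongly_prime R P"
    then have sm: "strongly_multiplicative R ?S"
      using strongly_prime_iff_strongly_multiplicative[OF P] by blast
    have "localize_ideal R ?S (carrier R \<inter> \<Inter>F) =
        carrier (localization R ?S) \<inter> (\<Inter>I\<in>F. localize_ideal R ?S I)"
      if F: "\<forall>I\<in>F. ideal I R" for F
    proof
      show "localize_ideal R ?S (carrier R \<inter> \<Inter>F) \<subseteq>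
          carrier (localization R ?S) \<inter> (\<Inter>I\<in>F. localize_ideal R ?S I)"
        by (auto simp: localize_ideal_def carrier_localization[OF S])
      show "carrier (localization R ?S) \<inter> (\<Inter>I\<in>F. localize_ideal R ?S I) \<subseteq>
          localize_ideal R ?S (carrier R \<inter> \<Inter>F)"
      proof
        fix x assume x: "x \<in> carrier (localization R ?S) \<inter> (\<Inter>I\<in>F. localize_ideal R ?S I)"
        then obtain a s where a: "a \<in> carrier R" "s \<in> ?S" "x = fraction R ?S a s"
          by (auto simp: carrier_localization[OF S])
        \<comment> \<open>Clearing denominators in \<open>a/s = b/t\<close> with
          \<open>b \<in> I\<close> gives a multiplier of \<open>a\<close> into \<open>I\<close>; it
          still depends on \<open>I\<close>.\<close>
        have den: "\<exists>w\<in>?S. w \<otimes> a \<in> I" if "I \<in> F" for I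
        proof -
          interpret ideal I R using F that by blast
          obtain b t where b: "b \<in> I" "t \<in> ?S" "x = fraction R ?S b t"
            using x \<open>I \<in> F\<close> by (auto simp: localize_ideal_def)
          then obtain u where u: "u \<in> ?S" "u \<otimes> ((a \<otimes> t) \<ominus> (b \<otimes> s)) = \<zero>"
            using a fraction_eq_iff[OF S a(1,2) Icarr[OF b(1)] b(2)] by auto
          have c: "s \<in> carrier R" "t \<in> carrier R" "u \<in> carrier R" "b \<in> carrier R"
            using a b u Icarr by auto
          have "(u \<otimes> t) \<otimes> a = u \<otimes> ((a \<otimes> t) \<ominus> (b \<otimes> s)) \<oplus> (u \<otimes> s) \<otimes> b"
            using a(1) c by algebra
          also have "\<dots> = (u \<otimes> s) \<otimes> b" using u c by simp
          also have "\<dots> \<in> I" using b c by (intro I_l_closed) auto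
          finally show ?thesis using Sm[OF u(1) b(2)] by blast
        qed
        \<comment> \<open>A common multiple \<open>t\<close> of all these multipliers works for
          every \<open>I\<close> at once, and expanding \<open>a/s\<close> by \<open>t\<close> puts
          the numerator into the intersection.\<close>
        let ?A = "{w \<in> ?S. \<exists>I\<in>F. w \<otimes> a \<in> I}"
        have "?A \<subseteq> ?S" by blast
        from strongly_multiplicativeD[OF sm this]
        obtain t where t: "t \<in> ?S" "\<And>w. w \<in> ?A \<Longrightarrow> t \<in> PIdl w" by blast
        have "t \<otimes> a \<in> I" if "I \<in> F" for I
        proof -
          obtain w where w: "w \<in> ?S" "w \<otimes> a \<in> I" using den[OF \<open>I \<in> F\<close>] by blast
          then obtain r where r: "r \<in> carrier R" "t = r \<otimes> w"
            using t(2)[of w] \<open>I \<in> F\<close> by (auto simp: cgenideal_def)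
          then have "t \<otimes> a = r \<otimes> (w \<otimes> a)" using w a by (auto simp: m_assoc)
          then show ?thesis using F that r w ideal.I_l_closed by metis
        qed
        then have "t \<otimes> a \<in> carrier R \<inter> \<Inter>F" using a t by auto
        moreover have "x = fraction R ?S (t \<otimes> a) (t \<otimes> s)"
          unfolding a(3)
        proof (rule fraction_eqI[OF S a(1,2) _ Sm[OF t(1) a(2)]])
          show "t \<otimes> a \<in> carrier R" using a t by auto
          show "a \<otimes> (t \<otimes> s) = t \<otimes> a \<otimes> s" using a t by (auto simp: m_ac)
        qed
        ultimately show "x \<in> localize_ideal R ?S (carrier R \<inter> \<Inter>F)"
          using Sm[OF t(1) a(2)] unfolding localize_ideal_def by blast
      qed
    qed
    then show "localization_commutes_with_Inter R P"
      unfolding localization_commutes_with_Inter_def by blast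
  next
    assume lc: "localization_commutes_with_Inter R P"
    have "\<exists>I\<in>F. I \<subseteq> P" if F: "\<forall>I\<in>F. ideal I R" "carrier R \<inter> \<Inter>F \<subseteq> P" for F
    proof (rule ccontr)
      assume n: "\<not> (\<exists>I\<in>F. I \<subseteq> P)"
      \<comment> \<open>An ideal not inside \<open>P\<close> localizes to the unit ideal, since it
        contains a denominator.\<close>
      have "fraction R ?S \<one> \<one> \<in> localize_ideal R ?S I" if "I \<in> F" for I
      proof -
        interpret ideal I R using F that by blast
        obtain s where s: "s \<in> I" "s \<in> ?S" using n \<open>I \<in> F\<close> Icarr by blast
        then have "fraction R ?S \<one> \<one> = fraction R ?S s s"
          using S1 Icarr by (intro fraction_eqI[OF S]) auto
        then show ?thesis using s unfolding localize_ideal_def by blast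
      qed
      then have "fraction R ?S \<one> \<one> \<in> localize_ideal R ?S (carrier R \<inter> \<Inter>F)"
        using lc F(1) fraction_closed[OF S one_closed S1]
        unfolding localization_commutes_with_Inter_def by blast
      then obtain a s where a: "a \<in> carrier R" "a \<in> P" "s \<in> ?S"
        "fraction R ?S \<one> \<one> = fraction R ?S a s"
        using F(2) unfolding localize_ideal_def by blast
      then obtain u where u: "u \<in> ?S" "u \<otimes> ((\<one> \<otimes> s) \<ominus> (a \<otimes> \<one>)) = \<zero>"
        using fraction_eq_iff[OF S one_closed S1 a(1,3)] by auto
      have c: "s \<in> carrier R" "u \<in> carrier R" using a u by auto
      \<comment> \<open>The product \<open>u \<otimes> s\<close> of two elements outside the prime
        \<open>P\<close> is forced into \<open>P\<close> through \<open>a\<close>.\<close>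
      have "u \<otimes> s = u \<otimes> ((\<one> \<otimes> s) \<ominus> (a \<otimes> \<one>)) \<oplus> u \<otimes> a" using a(1) c by algebra
      also have "\<dots> = u \<otimes> a" using u a c by simp
      also have "\<dots> \<in> P" using a c by (intro P.I_l_closed)
      finally show False using Sm[OF u(1) a(3)] by blast
    qed
    with P show "strongly_prime R P" unfolding strongly_prime_def by blast
  qed
qed

section \<open>Dimension zero and finiteness of the maximal spectrum\<close>

lemma strongly_prime_imp_maximal_among_primes:
  assumes sp: "strongly_prime R P" and Q: "primeideal Q R" and sub: "P \<subseteq> Q"
  shows "P = Q"
proof (rule ccontr)
  assume "P \<noteq> Q"
  have P: "primeideal P R" using sp by (simp add: strongly_prime_def)
  interpret P: primeideal P R by fact
  interpret Q: primeideal Q R by fact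
  obtain x where x: "x \<in> Q" "x \<notin> P" "x \<in> carrier R"
    using sub \<open>P \<noteq> Q\<close> Q.Icarr by blast
  have "strongly_multiplicative R (carrier R - P)"
    using sp strongly_prime_iff_strongly_multiplicative[OF P] by blast
  then obtain t where t: "t \<in> carrier R" "t \<notin> P"
      and t_mem: "\<And>s. s \<in> carrier R - P \<Longrightarrow> t \<in> PIdl s"
    using strongly_multiplicativeD[OF _ subset_refl] by blast
  \<comment> \<open>The common multiple \<open>t\<close> is compared with
    \<open>t \<otimes> x\<close>, itself an element outside \<open>P\<close>; this makes
    \<open>t\<close> a multiple of its own multiple.\<close>
  have "t \<otimes> x \<in> carrier R - P" using t x P.I_prime by blast
  from t_mem[OF this] obtain r where r: "r \<in> carrier R" "t = r \<otimes> (t \<otimes> x)"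
    by (auto simp: cgenideal_def)
  have "t \<otimes> (\<one> \<ominus> r \<otimes> x) = t \<ominus> r \<otimes> (t \<otimes> x)"
    using t(1) x(3) r(1) by algebra
  also have "\<dots> = \<zero>" using r t by (simp add: minus_eq r_neg)
  finally have "\<one> \<ominus> r \<otimes> x \<in> P"
    using P.I_prime[of t "\<one> \<ominus> r \<otimes> x"] P.zero_closed t x r by auto
  then have "(\<one> \<ominus> r \<otimes> x) \<oplus> r \<otimes> x \<in> Q"
    using sub x r by (intro Q.a_closed Q.I_l_closed) auto
  moreover have "(\<one> \<ominus> r \<otimes> x) \<oplus> r \<otimes> x = \<one>" using x(3) r(1) by algebra
  ultimately show False using primeideal_one_notin[OF Q] by simp
qed

text \<open>A strict inclusion of primes is a chain of length one, and a chain of positive length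
  starts with such an inclusion.\<close>

lemma zero_dimensional_iff:
  "zero_dimensional R \<longleftrightarrow>
    (\<forall>P Q. primeideal P R \<longrightarrow> primeideal Q R \<longrightarrow> P \<subseteq> Q \<longrightarrow> P = Q)"
proof
  assume z: "zero_dimensional R"
  show "\<forall>P Q. primeideal P R \<longrightarrow> primeideal Q R \<longrightarrow> P \<subseteq> Q \<longrightarrow> P = Q"
  proof (intro allI impI, rule ccontr)
    fix P Q assume PQ: "primeideal P R" "primeideal Q R" "P \<subseteq> Q" "P \<noteq> Q"
    then have "prime_chain R 1 (\<lambda>i. if i = 0 then P else Q)"
      by (auto simp: prime_chain_def)
    then have "enat 1 \<le> krull_dim R"
      unfolding krull_dim_def by (intro Sup_upper) blast
    then show False using z by (simp add: zero_dimensional_def enat_0_iff)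
  qed
next
  assume p: "\<forall>P Q. primeideal P R \<longrightarrow> primeideal Q R \<longrightarrow> P \<subseteq> Q \<longrightarrow> P = Q"
  have "n = 0" if "prime_chain R n P" for n P
  proof (rule ccontr)
    assume "n \<noteq> 0"
    then have "primeideal (P 0) R" "primeideal (P (Suc 0)) R" "P 0 \<subset> P (Suc 0)"
      using that by (auto simp: prime_chain_def)
    then show False using p by blast
  qed
  then have "krull_dim R \<le> 0"
    unfolding krull_dim_def by (intro Sup_least) (auto simp: zero_enat_def)
  then show "zero_dimensional R" by (simp add: zero_dimensional_def)
qed

text \<open>The ideal \<open>?J\<close> measures finiteness: \<open>\<one>\<close> lies in no
  maximal ideal, so \<open>\<one> \<in> ?J\<close> says that there are only finitely many. It
  therefore suffices that no maximal ideal contains \<open>?J\<close>.\<close>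

lemma finite_maximalideals_if_strongly_prime:
  assumes sp: "\<And>M. maximalideal M R \<Longrightarrow> strongly_prime R M"
  shows "finite {M. maximalideal M R}"
proof -
  let ?J = "{x \<in> carrier R. finite {M. maximalideal M R \<and> x \<notin> M}}"
  have cl: "\<zero> \<in> M" "\<And>x. x \<in> M \<Longrightarrow> \<ominus> x \<in> M" "\<And>x y. x \<in> M \<Longrightarrow> y \<in> M \<Longrightarrow> x \<oplus> y \<in> M"
    "\<And>a x. a \<in> M \<Longrightarrow> x \<in> carrier R \<Longrightarrow> x \<otimes> a \<in> M" if "maximalideal M R" for M
  proof -
    interpret maximalideal M R by fact
    show "\<zero> \<in> M" "\<And>x. x \<in> M \<Longrightarrow> \<ominus> x \<in> M" "\<And>x y. x \<in> M \<Longrightarrow> y \<in> M \<Longrightarrow> x \<oplus> y \<in> M"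
      "\<And>a x. a \<in> M \<Longrightarrow> x \<in> carrier R \<Longrightarrow> x \<otimes> a \<in> M"
      by (simp_all add: I_l_closed)
  qed
  have "ideal ?J R"
  proof (rule idealI[OF ring_axioms])
    show "subgroup ?J (add_monoid R)"
    proof (rule add.subgroupI)
      show "?J \<subseteq> carrier R" by blast
      have "{M. maximalideal M R \<and> \<zero> \<notin> M} = {}"
        using cl(1) by blast
      then have "\<zero> \<in> ?J" by (simp only: mem_Collect_eq finite.emptyI zero_closed simp_thms)
      then show "?J \<noteq> {}" by blast
      fix x y assume x: "x \<in> ?J"
      have inv: "{M. maximalideal M R \<and> \<ominus> x \<notin> M} \<subseteq> {M. maximalideal M R \<and> x \<notin> M}"
        using cl(2) by blast
      from x finite_subset[OF inv] show "\<ominus> x \<in> ?J" by simp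
      assume y: "y \<in> ?J"
      have add: "{M. maximalideal M R \<and> x \<oplus> y \<notin> M} \<subseteq>
          {M. maximalideal M R \<and> x \<notin> M} \<union> {M. maximalideal M R \<and> y \<notin> M}"
        using cl(3) by blast
      from x y finite_subset[OF add] show "x \<oplus> y \<in> ?J" by simp
    qed
  next
    fix a x assume ax: "a \<in> ?J" "x \<in> carrier R"
    have mult: "{M. maximalideal M R \<and> x \<otimes> a \<notin> M} \<subseteq> {M. maximalideal M R \<and> a \<notin> M}"
      using cl(4) ax(2) by blast
    from ax finite_subset[OF mult] show "x \<otimes> a \<in> ?J" by simp
    then show "a \<otimes> x \<in> ?J" using ax m_comm[of a x] by auto
  qed
  moreover have "\<not> ?J \<subseteq> M" if M: "maximalideal M R" for M
  proof
    assume sub: "?J \<subseteq> M"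
    let ?F = "{N. maximalideal N R \<and> N \<noteq> M}"
    \<comment> \<open>An element of all maximal ideals other than \<open>M\<close> is missed by at
      most \<open>M\<close>. If \<open>?J\<close> were inside \<open>M\<close>, strong primeness
      would put one of these other ideals inside \<open>M\<close>.\<close>
    have "carrier R \<inter> \<Inter>?F \<subseteq> ?J"
    proof
      fix x assume x: "x \<in> carrier R \<inter> \<Inter>?F"
      then have "{N. maximalideal N R \<and> x \<notin> N} \<subseteq> {M}" by blast
      from finite_subset[OF this] show "x \<in> ?J" using x by simp
    qed
    moreover have "\<forall>I\<in>?F. ideal I R" by (simp add: maximalideal.axioms(1))
    ultimately obtain N where N: "maximalideal N R" "N \<noteq> M" "N \<subseteq> M"
      using sp[OF M] sub unfolding strongly_prime_def by (smt (verit) mem_Collect_eq subset_trans)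
    interpret M: maximalideal M R by fact
    have "M = N \<or> M = carrier R"
      using maximalideal.I_maximal[OF N(1) M.is_ideal N(3)] M.Icarr by blast
    then show False using N M.I_notcarr by blast
  qed
  ultimately have "\<one> \<in> ?J" using exists_maximalideal by blast
  then have "finite {M. maximalideal M R \<and> \<one> \<notin> M}" by blast
  moreover have "{M. maximalideal M R} \<subseteq> {M. maximalideal M R \<and> \<one> \<notin> M}"
    using maximalideal_prime primeideal_one_notin by blast
  ultimately show ?thesis by (rule rev_finite_subset)
qed

section \<open>From finitely many incomparable primes to strong primeness\<close>

lemma exists_mem_ideals_notin_prime:
  assumes "finite F" and P: "primeideal P R" and "\<forall>I\<in>F. ideal I R \<and> \<not> I \<subseteq> P"
  shows "\<exists>x\<in>carrier R - P. \<forall>I\<in>F. x \<in> I"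
  using assms(1,3)
proof (induction F)
  case empty
  then show ?case using primeideal_one_notin[OF P] by blast
next
  case (insert I F)
  then obtain x where x: "x \<in> carrier R - P" "\<forall>J\<in>F. x \<in> J" by blast
  interpret I: ideal I R using insert.prems by blast
  obtain y where y: "y \<in> I" "y \<notin> P" using insert.prems by blast
  have yc: "y \<in> carrier R" using y I.Icarr by blast
  have "y \<otimes> x \<in> carrier R - P" using primeideal.I_prime[OF P yc] x y yc by blast
  moreover have "y \<otimes> x \<in> J" if "J \<in> F" for J
    using insert.prems x yc that by (intro ideal.I_l_closed) auto
  moreover have "y \<otimes> x \<in> I" using x y by (auto intro: I.I_r_closed)
  ultimately show ?case by blast
qed

text \<open>It is enough to find one element outside \<open>P\<close> that lies in every ideal not
  contained in \<open>P\<close>; a power of \<open>w\<close> will do.\<close>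

lemma zero_dimensional_quasi_semilocal_imp_strongly_prime:
  assumes zd: "zero_dimensional R" and qs: "quasi_semilocal R" and P: "primeideal P R"
  shows "strongly_prime R P"
proof -
  interpret P: primeideal P R by fact
  have eq: "P' = Q" if "primeideal P' R" "primeideal Q R" "P' \<subseteq> Q" for P' Q
    using zd that zero_dimensional_iff by blast
  \<comment> \<open>Every prime equals the maximal ideal above it, so finitely many maximal ideals
    means finitely many primes.\<close>
  have maximal: "maximalideal Q R" if Q: "primeideal Q R" for Q
  proof -
    obtain M where "maximalideal M R" "Q \<subseteq> M"
      using exists_maximalideal[of Q] primeideal_one_notin[OF Q] primeideal.axioms(1)[OF Q] by blast
    with eq[OF Q] maximalideal_prime show ?thesis by metis
  qed
  let ?F = "{Q. primeideal Q R \<and> Q \<noteq> P}"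
  have "?F \<subseteq> {M. maximalideal M R}" using maximal by blast
  then have fin: "finite ?F"
    using qs finite_subset unfolding quasi_semilocal_def by blast
  have "\<forall>I\<in>?F. ideal I R \<and> \<not> I \<subseteq> P"
    using eq[OF _ P] by (auto intro: primeideal.axioms(1))
  from exists_mem_ideals_notin_prime[OF fin P this] obtain x where x: "x \<in> carrier R" "x \<notin> P"
    and x_mem: "\<And>Q. primeideal Q R \<Longrightarrow> Q \<noteq> P \<Longrightarrow> x \<in> Q"
    by blast
  interpret Px: ideal "P <+>\<^bsub>R\<^esub> PIdl x" R by (rule ideal_add_PIdl(1)[OF P.is_ideal x(1)])
  have "P <+>\<^bsub>R\<^esub> PIdl x = P \<or> P <+>\<^bsub>R\<^esub> PIdl x = carrier R"
    using maximalideal.I_maximal[OF maximal[OF P] Px.is_ideal] Px.a_subset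
      ideal_add_PIdl(2)[OF P.is_ideal x(1)] by blast
  then have "\<one> \<in> P <+>\<^bsub>R\<^esub> PIdl x" using ideal_add_PIdl(3)[OF P.is_ideal x(1)] x(2) by auto
  then obtain v y where v: "v \<in> P" "y \<in> carrier R" "\<one> = v \<oplus> y \<otimes> x"
    by (rule mem_ideal_add_PIdlE)
  define w where "w = y \<otimes> x"
  have c: "v \<in> carrier R" "w \<in> carrier R" using v x P.Icarr by (auto simp: w_def)
  have one: "v \<oplus> w = \<one>" using v by (simp add: w_def)
  have w_mem: "w \<in> Q" if "primeideal Q R" "Q \<noteq> P" for Q
    unfolding w_def
    using x_mem[OF that] v by (intro ideal.I_l_closed primeideal.axioms(1)[OF that(1)])
  \<comment> \<open>Membership comes from \<open>v\<close> at the prime \<open>P\<close> and from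
    \<open>w\<close> at all others.\<close>
  have "w \<otimes> v \<in> Q" if Q: "primeideal Q R" for Q
  proof -
    interpret Q: ideal Q R using Q by (rule primeideal.axioms(1))
    show ?thesis
      using w_mem[OF Q] v(1) c by (cases "Q = P") (auto intro: P.I_l_closed Q.I_r_closed)
  qed
  then obtain n :: nat where n: "(w \<otimes> v) [^] n = \<zero>"
    using nilpotent_if_mem_all_primes[of "w \<otimes> v"] c by auto
  have "w \<notin> P"
    using P.a_closed[OF v(1), of w] one primeideal_one_notin[OF P] by auto
  then have wn: "w [^] n \<in> carrier R - P" using primeideal_nat_pow[OF P c(2), of n] nat_pow_closed[OF c(2)] by blast
  have "w [^] n \<in> I" if I: "ideal I R" "\<not> I \<subseteq> P" for I
  proof (rule ccontr)
    assume "w [^] n \<notin> I"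
    interpret I: ideal I R by fact
    \<comment> \<open>This is the ideal quotient of \<open>I\<close> by \<open>w [^] n\<close>,
      proper because \<open>w [^] n \<notin> I\<close>. A prime \<open>Q\<close> above it contains
      \<open>v\<close>, as \<open>v [^] n\<close> is killed by \<open>w [^] n\<close>; it also
      contains \<open>I\<close>, so it differs from \<open>P\<close> and contains \<open>w\<close>.
      Then \<open>v \<oplus> w = \<one>\<close> lies in \<open>Q\<close>.\<close>
    let ?J = "{r \<in> carrier R. w [^] n \<otimes> r \<in> I}"
    have "ideal ?J R" using c by (intro I.helper_max_prime is_cring) auto
    moreover have "\<one> \<notin> ?J" using \<open>w [^] n \<notin> I\<close> c by auto
    ultimately obtain Q where Q: "primeideal Q R" "?J \<subseteq> Q" using exists_primeideal[of ?J] by blast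
    have "w [^] n \<otimes> v [^] n = \<zero>" using n c by (simp add: nat_pow_distrib)
    then have "v [^] n \<in> ?J" using c I.zero_closed by auto
    then have "v \<in> Q" using primeideal_nat_pow[OF Q(1) c(1), of n] Q(2) by blast
    moreover have "I \<subseteq> ?J" using c I.Icarr by (auto intro: I.I_l_closed)
    then have "Q \<noteq> P" using I(2) Q(2) by blast
    then have "w \<in> Q" by (rule w_mem[OF Q(1)])
    ultimately have "v \<oplus> w \<in> Q"
      by (rule additive_subgroup.a_closed[OF ideal.axioms(1)[OF primeideal.axioms(1)[OF Q(1)]]])
    then show False using one primeideal_one_notin[OF Q(1)] by simp
  qed
  then have "\<exists>I\<in>F. I \<subseteq> P" if "\<forall>I\<in>F. ideal I R" "carrier R \<inter> \<Inter>F \<subseteq> P" for F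
    using that wn by blast
  with P show ?thesis unfolding strongly_prime_def by blast
qed

end

theorem corollary3p3:
  fixes R :: "('a, 'b) ring_scheme" (structure)
  assumes "cring R" and "\<one> \<noteq> \<zero>"
  shows
    "(strongly_zero_dimensional R \<longleftrightarrow>
        (\<forall>P. primeideal P R \<longrightarrow> strongly_multiplicative R (carrier R - P))) \<and>
     (strongly_zero_dimensional R \<longleftrightarrow>
        (\<forall>P. primeideal P R \<longrightarrow> localization_commutes_with_Inter R P)) \<and>
     (strongly_zero_dimensional R \<longleftrightarrow>
        zero_dimensional R \<and> quasi_semilocal R)"
proof -
  interpret cring R by fact
  \<comment> \<open>Maximal ideals are prime, hence strongly prime here, which gives the
    finiteness.\<close>
  have "zero_dimensional R \<and> quasi_semilocal R" if "strongly_zero_dimensional R"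
    using that strongly_prime_imp_maximal_among_primes zero_dimensional_iff
      finite_maximalideals_if_strongly_prime maximalideal_prime
    unfolding strongly_zero_dimensional_def quasi_semilocal_def by metis
  then show ?thesis
    using strongly_prime_iff_strongly_multiplicative strongly_prime_iff_localization_commutes
      zero_dimensional_quasi_semilocal_imp_strongly_prime
    unfolding strongly_zero_dimensional_def by blast
qed

end
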